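(* Let $0\le r\le n$ be integers, let $[p,q]$ be a compact real interval, let $x_0,x_1,\dots,x_{r-1}\in[p,q]$ be $r$ numbers, let $x_r,x_{r+1},\dots,x_n\in[p,q]$ be $n-r+1$ distinct numbers, let $x\in[p,q]$, and let $f\in C^{n+1}[p,q]$. Let $D_{r,r+1,\dots,n}[x]$ and $d_{r,r+1,\dots,n}[x]$ be the Neville and Aitken iterates of the divided differences $f[x_j,x_0,\dots,x_{r-1}]$ ($j=r,\dots,n$) defined in the context. Then for some $\xi$ in the smallest closed interval containing $x,x_0,x_1,\dots,x_n$: (i) $$f(x)=\sum_{i=0}^{r-1}f[x_0,x_1,\dots,x_i]\prod_{j=0}^{i-1}(x-x_j)+D_{r,r+1,\dots,n}[x]\prod_{i=0}^{r-1}(x-x_i)+\frac{f^{(n+1)}(\xi)}{(n+1)!}\prod_{i=0}^{n}(x-x_i);$$ (ii) $$f(x)=\sum_{i=0}^{r-1}f[x_0,x_1,\dots,x_i]\prod_{j=0}^{i-1}(x-x_j)+d_{r,r+1,\dots,n}[x]\prod_{i=0}^{r-1}(x-x_i)+\frac{f^{(n+1)}(\xi)}{(n+1)!}\prod_{i=0}^{n}(x-x_i).$$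
   Context: Empty sums are $0$ and empty products are $1$. Divided differences: $f[y_0,\dots,y_m]$ denotes the usual divided difference of order $m$ of $f$ at $y_0,\dots,y_m$, understood in the confluent (Hermite) sense when points coincide, i.e. the coefficient of $y^m$ in the polynomial of degree $\le m$ that interpolates $f$ at $y_0,\dots,y_m$ with multiplicity; in particular $f[y]=f(y)$ and $f[y,\dots,y]$ ($k+1$ times) $=f^{(k)}(y)/k!$. Neville iterates: for $j=r,\dots,n$ put $D_j[x]=f[x_j,x_0,x_1,\dots,x_{r-1}]$ (so $D_j[x]=f(x_j)$ if $r=0$). For $i=1,\dots,n-r$ and $j=r,\dots,n-i$ put $$D_{j,j+1,\dots,j+i}[x]=\frac{1}{x_{i+j}-x_j}\begin{vmatrix} D_{j,j+1,\dots,j+i-1}[x] & x_j-x\\ D_{j+1,j+2,\dots,j+i}[x] & x_{i+j}-x\end{vmatrix}.$$ Aitken iterates: for $j=r,\dots,n$ put $d_j[x]=f[x_j,x_0,x_1,\dots,x_{r-1}]$. For $i=r,\dots,n-1$ and $j=i+1,\dots,n$ put $$d_{r,r+1,\dots,i-1,i,j}[x]=\frac{1}{x_j-x_i}\begin{vmatrix} d_{r,r+1,\dots,i-1,i}[x] & x_i-x\\ d_{r,r+1,\dots,i-1,j}[x] & x_j-x\end{vmatrix},$$ where for $i=r$ the entries in the first column are $d_r[x]$ and $d_j[x]$. Vertical bars denote $2\times 2$ determinants. *)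

theory Defs
  imports "HOL-Analysis.Analysis" "HOL-Computational_Algebra.Polynomial"
begin

text \<open>Derivatives are taken relative to the set \<open>S\<close>, so that for \<open>S = {p..q}\<close> they are
  one-sided at the end points and do not depend on the values of \<open>f\<close> outside \<open>S\<close>.\<close>

primrec nderiv_on :: "real set \<Rightarrow> nat \<Rightarrow> (real \<Rightarrow> real) \<Rightarrow> real \<Rightarrow> real" where
  "nderiv_on S 0 f = f"
| "nderiv_on S (Suc k) f = (\<lambda>y. vector_derivative (nderiv_on S k f) (at y within S))"

definition Ck_on :: "nat \<Rightarrow> real set \<Rightarrow> (real \<Rightarrow> real) \<Rightarrow> bool" where
  "Ck_on k S f \<longleftrightarrow>
     (\<forall>j<k. nderiv_on S j f differentiable_on S) \<and> continuous_on S (nderiv_on S k f)"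

definition interpolates_on :: "real set \<Rightarrow> (real \<Rightarrow> real) \<Rightarrow> real list \<Rightarrow> real poly \<Rightarrow> bool" where
  "interpolates_on S f ys P \<longleftrightarrow>
     (\<forall>y\<in>set ys. \<forall>k<count_list ys y. poly ((pderiv ^^ k) P) y = nderiv_on S k f y)"

text \<open>The divided difference \<open>f[y\<^sub>0,\<dots>,y\<^sub>m]\<close> for \<open>ys = [y\<^sub>0,\<dots>,y\<^sub>m]\<close>. The list \<open>ys\<close> must be nonempty.\<close>

definition divdiff :: "real set \<Rightarrow> (real \<Rightarrow> real) \<Rightarrow> real list \<Rightarrow> real" where
  "divdiff S f ys =
     coeff (THE P. degree P \<le> length ys - 1 \<and> interpolates_on S f ys P) (length ys - 1)"

lemma divdiff_singleton: "divdiff S f [y] = f y"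
proof -
  have "(THE P. degree P \<le> length [y] - 1 \<and> interpolates_on S f [y] P) = [:f y:]"
    by (rule the_equality) (auto simp: interpolates_on_def elim!: degree_eq_zeroE)
  then show ?thesis
    by (simp add: divdiff_def)
qed

definition det2 :: "real \<Rightarrow> real \<Rightarrow> real \<Rightarrow> real \<Rightarrow> real" where
  "det2 a b c d = det (vector [vector [a, b], vector [c, d]] :: real^2^2)"

lemma det2_eq: "det2 a b c d = a * d - b * c"
  by (simp add: det2_def det_2)

text \<open>\<open>neville S f x r t i j\<close> is \<open>D\<^bsub>j,j+1,\<dots>,j+i\<^esub>[t]\<close>; the intended range is \<open>r \<le> j\<close> and \<open>j + i \<le> n\<close>.\<close>

primrec neville ::
  "real set \<Rightarrow> (real \<Rightarrow> real) \<Rightarrow> (nat \<Rightarrow> real) \<Rightarrow> nat \<Rightarrow> real \<Rightarrow> nat \<Rightarrow> nat \<Rightarrow> real" where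
  "neville S f x r t 0 j = divdiff S f (x j # map x [0..<r])"
| "neville S f x r t (Suc i) j =
     1 / (x (Suc i + j) - x j) *
       det2 (neville S f x r t i j)       (x j - t)
            (neville S f x r t i (Suc j)) (x (Suc i + j) - t)"

text \<open>\<open>aitken S f x r t k j\<close> is \<open>d\<^bsub>r,r+1,\<dots>,r+k-1,j\<^esub>[t]\<close>, with \<open>k\<close> indices before the last one; the
  intended range is \<open>r + k \<le> j \<le> n\<close>. In the second equation \<open>i = r + k\<close> is the pivot index.\<close>

primrec aitken ::
  "real set \<Rightarrow> (real \<Rightarrow> real) \<Rightarrow> (nat \<Rightarrow> real) \<Rightarrow> nat \<Rightarrow> real \<Rightarrow> nat \<Rightarrow> nat \<Rightarrow> real" where
  "aitken S f x r t 0 j = divdiff S f (x j # map x [0..<r])"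
| "aitken S f x r t (Suc k) j =
     1 / (x j - x (r + k)) *
       det2 (aitken S f x r t k (r + k)) (x (r + k) - t)
            (aitken S f x r t k j)       (x j - t)"

end

theory Submission
  imports Defs
begin

text \<open>Adding a node \<open>z\<close> to a list \<open>ys\<close> changes the Hermite interpolant by
  \<open>f[ys, z]\<close> times the node polynomial of \<open>ys\<close>. As the interpolant does not depend on the order
  of the nodes, adding \<open>a, b\<close> and \<open>b, a\<close> gives the divided difference recurrence, hence the
  interpolant at \<open>ys, a, b\<close> as a cross mean of those at \<open>ys, a\<close> and \<open>ys, b\<close>. So both iterates,
  multiplied by the node polynomial of \<open>x\<^sub>0, \<dots>, x\<^sub>r\<^sub>-\<^sub>1\<close>, are the difference of the interpolants at all
  nodes and at the first \<open>r\<close> nodes, and both claims reduce to the same Hermite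
  remainder formula, which follows from Rolle's theorem for zeros counted with multiplicity.\<close>

section \<open>Node polynomials and multiplicities of roots\<close>

definition node_poly :: "'a::comm_ring_1 list \<Rightarrow> 'a poly" where
  "node_poly ys = (\<Prod>y\<leftarrow>ys. [:- y, 1:])"

lemma node_poly_append: "node_poly (ys @ zs) = node_poly ys * node_poly zs"
  by (simp add: node_poly_def)

lemma node_poly_single: "node_poly [y] = [:- y, 1:]"
  by (simp add: node_poly_def)

lemma poly_node_poly: "poly (node_poly ys) a = (\<Prod>y\<leftarrow>ys. a - y)"
  by (induction ys) (simp_all add: node_poly_def algebra_simps)

lemma monic_node_poly:
  fixes ys :: "'a::idom list"
  shows "lead_coeff (node_poly ys) = 1" and "degree (node_poly ys) = length ys"
proof -
  have "lead_coeff (node_poly ys) = 1 \<and> degree (node_poly ys) = length ys"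
  proof (induction ys)
    case (Cons y ys)
    have split: "node_poly (y # ys) = [:- y, 1:] * node_poly ys"
      by (simp add: node_poly_def)
    have "node_poly ys \<noteq> 0"
      using Cons by force
    moreover have "coeff (node_poly ys) (length ys) = 1"
      using Cons by metis
    ultimately show ?case
      using Cons unfolding split lead_coeff_mult
      by (simp add: degree_mult_eq del: mult_pCons_left)
  qed (simp add: node_poly_def)
  then show "lead_coeff (node_poly ys) = 1" and "degree (node_poly ys) = length ys"
    by auto
qed

lemma node_poly_nonzero:
  fixes ys :: "'a::idom list"
  shows "node_poly ys \<noteq> 0"
  using monic_node_poly(1)[of ys] by force

lemma order_node_poly:
  fixes ys :: "'a::idom list"
  shows "order a (node_poly ys) = count_list ys a"
proof (induction ys)
  case (Cons y ys)
  have "node_poly (y # ys) = [:- y, 1:] * node_poly ys"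
    by (simp add: node_poly_def)
  moreover have "order a [:- y, 1:] = (if y = a then 1 else 0)"
    using order_power_n_n[of a 1] by (auto intro: order_0I)
  ultimately show ?case
    using Cons node_poly_nonzero[of "y # ys"] by (simp add: order_mult del: mult_pCons_left)
qed (simp add: node_poly_def)

text \<open>In characteristic 0, differentiation lowers the order of a root by exactly one. This
  links multiplicities with the derivative conditions of \<open>interpolates_on\<close>.\<close>

lemma le_order_iff_higher_pderiv:
  fixes P :: "'a::field_char_0 poly"
  assumes "P \<noteq> 0"
  shows "m \<le> order a P \<longleftrightarrow> (\<forall>k<m. poly ((pderiv ^^ k) P) a = 0)"
  using assms
proof (induction m arbitrary: P)
  case (Suc m)
  have split: "(\<forall>k<Suc m. poly ((pderiv ^^ k) P) a = 0) \<longleftrightarrow>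
      poly P a = 0 \<and> (\<forall>k<m. poly ((pderiv ^^ k) (pderiv P)) a = 0)"
    by (auto simp: less_Suc_eq_0_disj funpow_Suc_right simp del: funpow.simps)
  show ?case
  proof (cases "poly P a = 0")
    case True
    have "pderiv P \<noteq> 0"
    proof
      assume "pderiv P = 0"
      then obtain c where "P = [:c:]"
        by (auto simp: pderiv_eq_0_iff elim: degree_eq_zeroE)
      with True Suc.prems show False by simp
    qed
    with Suc.IH[of "pderiv P"] order_pderiv[OF Suc.prems True] split True show ?thesis
      by simp
  next
    case False
    with split show ?thesis by (simp add: order_0I)
  qed
qed simp

lemma higher_pderiv_node_poly_eq_0:
  fixes ys :: "'a::field_char_0 list"
  assumes "k < count_list ys a"
  shows "poly ((pderiv ^^ k) (node_poly ys)) a = 0"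
  using assms le_order_iff_higher_pderiv[OF node_poly_nonzero, of "count_list ys a" a ys]
  by (simp add: order_node_poly)

text \<open>One more vanishing derivative would make the order of the root exceed its count. The
  value is the divisor used when a node is appended to an interpolant.\<close>

lemma higher_pderiv_node_poly_nonzero:
  fixes ys :: "'a::field_char_0 list"
  shows "poly ((pderiv ^^ count_list ys a) (node_poly ys)) a \<noteq> 0"
proof
  assume "poly ((pderiv ^^ count_list ys a) (node_poly ys)) a = 0"
  then have "Suc (count_list ys a) \<le> order a (node_poly ys)"
    by (subst le_order_iff_higher_pderiv[OF node_poly_nonzero])
       (auto simp: less_Suc_eq higher_pderiv_node_poly_eq_0)
  then show False
    by (simp add: order_node_poly)
qed

lemma higher_pderiv_eq_fact_coeff:
  fixes P :: "'a::{comm_semiring_1,semiring_no_zero_divisors,semiring_char_0} poly"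
  assumes "degree P \<le> n"
  shows "poly ((pderiv ^^ n) P) a = fact n * coeff P n"
proof -
  have "degree ((pderiv ^^ n) P) = 0"
    using assms by (simp add: degree_higher_pderiv)
  then obtain c where c: "(pderiv ^^ n) P = [:c:]"
    by (rule degree_eq_zeroE)
  have "coeff ((pderiv ^^ n) P) 0 = fact n * coeff P n"
    by (simp add: coeff_higher_pderiv pochhammer_fact)
  then show ?thesis by (simp add: c)
qed

section \<open>Existence and uniqueness of Hermite interpolants\<close>

lemma higher_pderiv_diff:
  "(pderiv ^^ k) (P - Q) = (pderiv ^^ k) P - (pderiv ^^ k) (Q :: 'a::idom poly)"
  by (induction k) (simp_all add: pderiv_diff)

text \<open>The degree bound is stated through coefficients so that it also makes sense for the
  empty list, whose interpolant is \<open>0\<close>.\<close>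

definition is_hermite :: "real set \<Rightarrow> (real \<Rightarrow> real) \<Rightarrow> real list \<Rightarrow> real poly \<Rightarrow> bool" where
  "is_hermite S f ys P \<longleftrightarrow> (\<forall>k\<ge>length ys. coeff P k = 0) \<and> interpolates_on S f ys P"

text \<open>A nonzero difference of two interpolants would have at least \<open>length ys\<close>
  roots with multiplicity but smaller degree.\<close>

lemma is_hermite_unique:
  assumes "is_hermite S f ys P" and "is_hermite S f ys Q"
  shows "P = Q"
proof (rule ccontr)
  assume "P \<noteq> Q"
  define D where "D = P - Q"
  have "D \<noteq> 0" using \<open>P \<noteq> Q\<close> by (simp add: D_def)
  have "coeff D k = 0" if "length ys \<le> k" for k
    using assms that by (simp add: D_def is_hermite_def)
  then have "degree D < length ys"
    using \<open>D \<noteq> 0\<close> by (meson leading_coeff_0_iff not_le)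
  moreover have "count_list ys a \<le> order a D" for a
  proof (subst le_order_iff_higher_pderiv[OF \<open>D \<noteq> 0\<close>], intro allI impI)
    fix k assume "k < count_list ys a"
    moreover from this have "a \<in> set ys"
      by (metis count_notin not_less_zero)
    ultimately show "poly ((pderiv ^^ k) D) a = 0"
      using assms by (simp add: D_def is_hermite_def interpolates_on_def higher_pderiv_diff)
  qed
  then have "mset ys \<subseteq># proots D"
    using \<open>D \<noteq> 0\<close> by (simp add: subseteq_mset_def count_mset count_list_eq_length_filter)
  then have "length ys \<le> degree D"
    using size_mset_mono[of "mset ys" "proots D"] size_proots_le[of D] by simp
  ultimately show False by simp
qed

text \<open>Adding a multiple of the node polynomial disturbs no old condition, and the new
  condition is a linear equation for \<open>c\<close>.\<close>

lemma is_hermite_snoc: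
  assumes P: "is_hermite S f ys P"
  obtains c where "is_hermite S f (ys @ [z]) (P + smult c (node_poly ys))"
proof -
  define m where "m = count_list ys z"
  define w where "w = poly ((pderiv ^^ m) (node_poly ys)) z"
  define c where "c = (nderiv_on S m f z - poly ((pderiv ^^ m) P) z) / w"
  define Q where "Q = P + smult c (node_poly ys)"
  have "w \<noteq> 0"
    unfolding w_def m_def by (rule higher_pderiv_node_poly_nonzero)
  have eval: "poly ((pderiv ^^ k) Q) a
      = poly ((pderiv ^^ k) P) a + c * poly ((pderiv ^^ k) (node_poly ys)) a" for k a
    by (simp add: Q_def higher_pderiv_add higher_pderiv_smult)
  have "interpolates_on S f (ys @ [z]) Q"
    unfolding interpolates_on_def
  proof (intro ballI allI impI)
    fix a k assume k: "k < count_list (ys @ [z]) a"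
    show "poly ((pderiv ^^ k) Q) a = nderiv_on S k f a"
    proof (cases "k < count_list ys a")
      case True
      then have "a \<in> set ys"
        by (metis count_notin not_less_zero)
      with True P show ?thesis
        by (simp add: eval higher_pderiv_node_poly_eq_0 is_hermite_def interpolates_on_def)
    next
      case False
      \<comment> \<open>Appending \<open>z\<close> raises only the count of \<open>z\<close>, so the
        single new condition is that of order \<open>m\<close> at \<open>z\<close>.\<close>
      with k have "a = z" "k = m"
        by (auto simp: m_def split: if_splits)
      with \<open>w \<noteq> 0\<close> show ?thesis
        by (simp add: eval c_def flip: w_def)
    qed
  qed
  moreover have "coeff Q k = 0" if "length (ys @ [z]) \<le> k" for k
    using that P by (simp add: Q_def is_hermite_def coeff_eq_0 monic_node_poly)
  ultimately have "is_hermite S f (ys @ [z]) Q"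
    by (simp add: is_hermite_def)
  then show thesis
    using that by (simp add: Q_def)
qed

definition hermite :: "real set \<Rightarrow> (real \<Rightarrow> real) \<Rightarrow> real list \<Rightarrow> real poly" where
  "hermite S f ys = (THE P. is_hermite S f ys P)"

lemma hermite_eqI: "is_hermite S f ys P \<Longrightarrow> hermite S f ys = P"
  unfolding hermite_def using is_hermite_unique by blast

lemma is_hermite_hermite: "is_hermite S f ys (hermite S f ys)"
proof -
  have "\<exists>P. is_hermite S f ys P"
  proof (induction ys rule: rev_induct)
    case Nil
    have "is_hermite S f [] 0"
      by (simp add: is_hermite_def interpolates_on_def)
    then show ?case ..
  qed (metis is_hermite_snoc)
  then show ?thesis
    using hermite_eqI by metis
qed

lemma hermite_Nil [simp]: "hermite S f [] = 0"
  by (rule hermite_eqI) (simp add: is_hermite_def interpolates_on_def)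

text \<open>The interpolation conditions see the list only through its counts, set and length. This
  permits reordering the nodes.\<close>

lemma hermite_cong_mset:
  assumes "mset ys = mset zs"
  shows "hermite S f ys = hermite S f zs"
proof -
  have "count_list ys = count_list zs"
    using assms by (metis count_list_eq_length_filter count_mset ext)
  moreover have "set ys = set zs" "length ys = length zs"
    using assms mset_eq_setD mset_eq_length by blast+
  ultimately show ?thesis
    by (simp add: hermite_def is_hermite_def interpolates_on_def)
qed

section \<open>Divided differences and the Newton form\<close>

lemma divdiff_eq_coeff_hermite:
  assumes "ys \<noteq> []"
  shows "divdiff S f ys = coeff (hermite S f ys) (length ys - 1)"
proof -
  have "degree P \<le> length ys - 1 \<longleftrightarrow> (\<forall>k\<ge>length ys. coeff P k = 0)" for P :: "real poly"
    using assms by (cases ys) (auto simp: coeff_eq_0 Suc_le_eq intro: degree_le)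
  then show ?thesis
    by (simp add: divdiff_def hermite_def is_hermite_def)
qed

lemma divdiff_cong_mset:
  assumes "mset ys = mset zs" and "ys \<noteq> []"
  shows "divdiff S f ys = divdiff S f zs"
  using assms by (metis divdiff_eq_coeff_hermite hermite_cong_mset mset_eq_length mset_zero_iff)

text \<open>The node polynomial is monic of degree \<open>length ys\<close>, where the old
  interpolant has coefficient 0, so the factor of the correction is the new divided
  difference.\<close>

lemma hermite_snoc:
  "hermite S f (ys @ [z]) = hermite S f ys + smult (divdiff S f (ys @ [z])) (node_poly ys)"
proof -
  obtain c where c: "is_hermite S f (ys @ [z]) (hermite S f ys + smult c (node_poly ys))"
    using is_hermite_snoc is_hermite_hermite by metis
  have "coeff (hermite S f ys) (length ys) = 0"
    using is_hermite_hermite[of S f ys] by (simp add: is_hermite_def)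
  moreover have "coeff (node_poly ys) (length ys) = 1"
    using monic_node_poly[of ys] by metis
  ultimately have "divdiff S f (ys @ [z]) = c"
    using hermite_eqI[OF c] by (simp add: divdiff_eq_coeff_hermite)
  with hermite_eqI[OF c] show ?thesis by simp
qed

text \<open>The Newton forms for the orders \<open>a, b\<close> and \<open>b, a\<close> describe one
  polynomial; cancelling \<open>W\<close> and comparing constant terms gives the claim. Without
  division it also covers \<open>a = b\<close>.\<close>

lemma divdiff_recurrence:
  "(b - a) * divdiff S f (ys @ [a, b]) = divdiff S f (ys @ [b]) - divdiff S f (ys @ [a])"
proof -
  define W where "W = node_poly ys"
  define g where "g = divdiff S f (ys @ [a, b])"
  have newton: "hermite S f (ys @ [u, v]) = hermite S f ys
      + W * ([:divdiff S f (ys @ [u]):] + [:- u, 1:] * [:divdiff S f (ys @ [u, v]):])" for u v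
    using hermite_snoc[of S f "ys @ [u]" v]
    by (intro poly_eq_poly_eq_iff[THEN iffD1] ext)
       (simp add: hermite_snoc node_poly_append node_poly_single W_def algebra_simps)
  have swap: "divdiff S f (ys @ [b, a]) = g" "hermite S f (ys @ [b, a]) = hermite S f (ys @ [a, b])"
    unfolding g_def by (rule divdiff_cong_mset hermite_cong_mset; simp)+
  have "W * ([:divdiff S f (ys @ [a]):] + [:- a, 1:] * [:g:])
      = W * ([:divdiff S f (ys @ [b]):] + [:- b, 1:] * [:g:])"
    using newton[of a b] newton[of b a] unfolding swap g_def[symmetric] by simp
  then have "[:divdiff S f (ys @ [a]):] + [:- a, 1:] * [:g:]
      = [:divdiff S f (ys @ [b]):] + [:- b, 1:] * [:g:]"
    using node_poly_nonzero[of ys] unfolding W_def by (simp only: mult_cancel_left if_False) blast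
  then show ?thesis
    by (simp add: algebra_simps flip: g_def)
qed

text \<open>Both schemes perform this cross-mean step; they differ only in which nodes play the roles
  of \<open>a\<close> and \<open>b\<close>.\<close>

lemma hermite_cross_mean:
  assumes "a \<noteq> b"
  shows "poly (hermite S f (ys @ [a, b])) t
    = ((b - t) * poly (hermite S f (ys @ [a])) t + (t - a) * poly (hermite S f (ys @ [b])) t)
      / (b - a)"
proof -
  define w where "w = poly (node_poly ys) t"
  define \<alpha> where "\<alpha> = divdiff S f (ys @ [a])"
  define \<beta> where "\<beta> = divdiff S f (ys @ [b])"
  define \<gamma> where "\<gamma> = divdiff S f (ys @ [a, b])"
  define h where "h = poly (hermite S f ys) t"
  have ab: "poly (hermite S f (ys @ [a, b])) t = h + w * (\<alpha> + (t - a) * \<gamma>)"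
    using hermite_snoc[of S f "ys @ [a]" b]
    by (simp add: hermite_snoc node_poly_append node_poly_single w_def \<alpha>_def \<gamma>_def h_def
        algebra_simps)
  have a: "poly (hermite S f (ys @ [a])) t = h + w * \<alpha>"
    and b: "poly (hermite S f (ys @ [b])) t = h + w * \<beta>"
    by (simp_all add: hermite_snoc w_def \<alpha>_def \<beta>_def h_def)
  \<comment> \<open>With \<open>\<beta>\<close> eliminated, the claim rests on \<open>(b - t) *
    \<alpha> + (t - a) * \<beta> = (b - a) * (\<alpha> + (t - a) * \<gamma>)\<close>.\<close>
  have \<beta>: "\<beta> = \<alpha> + (b - a) * \<gamma>"
    using divdiff_recurrence[of b a S f ys] by (simp add: \<alpha>_def \<beta>_def \<gamma>_def)
  show ?thesis
    using assms unfolding ab a b \<beta> by (simp add: field_simps)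
qed

lemma hermite_newton:
  "poly (hermite S f (map x [0..<r])) t
    = (\<Sum>i<r. divdiff S f (map x [0..<Suc i]) * (\<Prod>j<i. t - x j))"
proof (induction r)
  case (Suc r)
  have "poly (node_poly (map x [0..<r])) t = (\<Prod>j<r. t - x j)"
    by (simp add: poly_node_poly o_def prod.list_conv_set_nth atLeast0LessThan)
  then show ?case
    using Suc by (simp add: hermite_snoc)
qed simp

section \<open>The Neville and Aitken schemes\<close>

text \<open>Base case of both schemes: the iterates list \<open>y\<close> first, the Newton step
  appends it last, and symmetry of divided differences reconciles the two.\<close>

lemma hermite_first_step:
  "divdiff S f (y # ys) * poly (node_poly ys) t
    = poly (hermite S f (ys @ [y])) t - poly (hermite S f ys) t"
  using divdiff_cong_mset[of "ys @ [y]" "y # ys" S f] by (simp add: hermite_snoc)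

text \<open>Multiplying by the node polynomial avoids a division that would fail when
  \<open>t\<close> is one of the first \<open>r\<close> nodes.\<close>

lemma neville_hermite:
  fixes x :: "nat \<Rightarrow> real"
  assumes "inj_on x {r..n}" and "r \<le> j" and "j + i \<le> n"
  shows "neville S f x r t i j * poly (node_poly (map x [0..<r])) t
    = poly (hermite S f (map x [0..<r] @ map x [j..<Suc (j + i)])) t
      - poly (hermite S f (map x [0..<r])) t"
  using assms(2,3)
proof (induction i arbitrary: j)
  case 0
  then show ?case
    by (simp add: hermite_first_step)
next
  case (Suc i)
  define B where "B = map x [0..<r]"
  define M where "M = B @ map x [Suc j..<Suc (j + i)]"
  define a where "a = x j"
  define b where "b = x (Suc i + j)"
  define h where "h ys = poly (hermite S f ys) t" for ys
  define w where "w = poly (node_poly B) t"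
  have "a \<noteq> b"
    using Suc.prems inj_onD[OF assms(1), of j "Suc i + j"] by (auto simp: a_def b_def)
  \<comment> \<open>\<open>M\<close> collects the nodes common to both entries. The left entry has
    \<open>a\<close> in front of the shared block, so it is moved to the end.\<close>
  have "mset (B @ map x [j..<Suc (j + i)]) = mset (M @ [a])"
    by (simp add: M_def a_def upt_conv_Cons del: upt_Suc)
  then have "h (B @ map x [j..<Suc (j + i)]) = h (M @ [a])"
    unfolding h_def by (metis hermite_cong_mset)
  then have 1: "neville S f x r t i j * w = h (M @ [a]) - h B"
    using Suc.IH[of j] Suc.prems by (simp add: B_def h_def w_def)
  have "B @ map x [Suc j..<Suc (Suc j + i)] = M @ [b]"
    by (simp add: M_def b_def add.commute)
  then have 2: "neville S f x r t i (Suc j) * w = h (M @ [b]) - h B"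
    using Suc.IH[of "Suc j"] Suc.prems by (simp add: B_def h_def w_def del: upt_Suc)
  have "[j..<Suc (j + Suc i)] = j # [Suc j..<Suc (j + i)] @ [Suc i + j]"
    by (simp add: upt_conv_Cons add.commute)
  then have "mset (B @ map x [j..<Suc (j + Suc i)]) = mset (M @ [a, b])"
    by (simp add: M_def a_def b_def del: upt_Suc)
  then have 3: "h (B @ map x [j..<Suc (j + Suc i)]) = h (M @ [a, b])"
    unfolding h_def by (metis hermite_cong_mset)
  have "neville S f x r t (Suc i) j * w
      = ((b - t) * (neville S f x r t i j * w) + (t - a) * (neville S f x r t i (Suc j) * w))
        / (b - a)"
    by (simp add: det2_eq a_def b_def algebra_simps diff_divide_distrib add_divide_distrib)
  \<comment> \<open>The weights \<open>b - t\<close> and \<open>t - a\<close> sum to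
    \<open>b - a\<close>, so the subtracted \<open>h B\<close> passes through the mean
    unchanged.\<close>
  also have "\<dots> = h (M @ [a, b]) - h B"
    using \<open>a \<noteq> b\<close> unfolding 1 2 h_def hermite_cross_mean[OF \<open>a \<noteq> b\<close>]
    by (simp add: field_simps)
  finally show ?case
    using 3 by (simp add: B_def h_def w_def)
qed

text \<open>Here the pivot \<open>x (r + k)\<close> and the node \<open>x j\<close> extend the same
  initial segment, so the lists already have the order of the cross mean.\<close>

lemma aitken_hermite:
  fixes x :: "nat \<Rightarrow> real"
  assumes "inj_on x {r..n}" and "r + k \<le> j" and "j \<le> n"
  shows "aitken S f x r t k j * poly (node_poly (map x [0..<r])) t
    = poly (hermite S f (map x [0..<r + k] @ [x j])) t - poly (hermite S f (map x [0..<r])) t"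
  using assms(2,3)
proof (induction k arbitrary: j)
  case 0
  then show ?case
    by (simp add: hermite_first_step)
next
  case (Suc k)
  define M where "M = map x [0..<r + k]"
  define a where "a = x (r + k)"
  define b where "b = x j"
  define h where "h ys = poly (hermite S f ys) t" for ys
  define w where "w = poly (node_poly (map x [0..<r])) t"
  have "a \<noteq> b"
    using Suc.prems inj_onD[OF assms(1), of "r + k" j] by (auto simp: a_def b_def)
  have 1: "aitken S f x r t k (r + k) * w = h (M @ [a]) - h (map x [0..<r])"
    using Suc.IH[of "r + k"] Suc.prems by (simp add: M_def a_def h_def w_def)
  have 2: "aitken S f x r t k j * w = h (M @ [b]) - h (map x [0..<r])"
    using Suc.IH[of j] Suc.prems by (simp add: M_def b_def h_def w_def)
  have "aitken S f x r t (Suc k) j * w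
      = ((b - t) * (aitken S f x r t k (r + k) * w) + (t - a) * (aitken S f x r t k j * w))
        / (b - a)"
    by (simp add: det2_eq a_def b_def algebra_simps diff_divide_distrib add_divide_distrib)
  also have "\<dots> = h (M @ [a, b]) - h (map x [0..<r])"
    using \<open>a \<noteq> b\<close> unfolding 1 2 h_def hermite_cross_mean[OF \<open>a \<noteq> b\<close>]
    by (simp add: field_simps)
  finally show ?case
    by (simp add: M_def a_def b_def h_def w_def)
qed

section \<open>Rolle's theorem for zeros with multiplicity\<close>

text \<open>The induction turns an increasing list of zeros of \<open>g 0\<close>, in which a repetition
  \<open>y i = \<dots> = y j\<close> stands for vanishing up to order \<open>j - i\<close>, into a list of the same kind for
  \<open>g 1\<close> that is shorter by one: a repeated zero is kept, a gap is replaced by a Rolle point.\<close>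

lemma generalized_Rolle:
  fixes g :: "nat \<Rightarrow> real \<Rightarrow> real" and y :: "nat \<Rightarrow> real"
  assumes "\<And>k u. k < N \<Longrightarrow> u \<in> {p..q} \<Longrightarrow>
      (g k has_real_derivative g (Suc k) u) (at u within {p..q})"
    and "\<And>i j. i \<le> j \<Longrightarrow> j \<le> N \<Longrightarrow> y i \<le> y j"
    and "\<And>i j. i \<le> j \<Longrightarrow> j \<le> N \<Longrightarrow> y i = y j \<Longrightarrow> g (j - i) (y i) = 0"
    and "p \<le> y 0" and "y N \<le> q"
  shows "\<exists>\<xi>\<in>{y 0..y N}. g N \<xi> = 0"
  using assms
proof (induction N arbitrary: g y)
  case 0
  then show ?case by force
next
  case (Suc N)
  note der = Suc.prems(1) and mono = Suc.prems(2) and zero = Suc.prems(3)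
  \<comment> \<open>The strict clause serves to trace equal Rolle points back to repeated
    zeros.\<close>
  have "\<exists>z. y i \<le> z \<and> z \<le> y (Suc i) \<and> g 1 z = 0 \<and>
      (y i < y (Suc i) \<longrightarrow> y i < z \<and> z < y (Suc i))" if "i \<le> N" for i
  proof (cases "y i < y (Suc i)")
    case True
    have range: "p \<le> y i" "y (Suc i) \<le> q"
      using mono[of 0 i] mono[of "Suc i" "Suc N"] Suc.prems(4,5) that by simp_all
    have "continuous_on {p..q} (g 0)"
      using der[of 0] by (meson DERIV_continuous_on zero_less_Suc)
    then have "continuous_on {y i..y (Suc i)} (g 0)"
      using range by (auto elim: continuous_on_subset)
    moreover have "(g 0 has_derivative (*) (g 1 u)) (at u)" if "y i < u" "u < y (Suc i)" for u
    proof -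
      have "u \<in> interior {p..q}"
        using that range by simp
      then have "at u within {p..q} = at u"
        by (rule at_within_interior)
      then show ?thesis
        using der[of 0 u] that range by (simp add: has_field_derivative_def)
    qed
    moreover have "g 0 (y i) = g 0 (y (Suc i))"
      using zero[of i i] zero[of "Suc i" "Suc i"] that by simp
    ultimately obtain z where "y i < z" "z < y (Suc i)" "(*) (g 1 z) = (\<lambda>v. 0)"
      using Rolle_deriv[OF True, of "g 0" "\<lambda>u. (*) (g 1 u)"] by blast
    then show ?thesis
      using fun_cong[of "(*) (g 1 z)" "\<lambda>v. 0" 1] by (metis less_imp_le mult.right_neutral)
  next
    case False
    \<comment> \<open>Here \<open>y i = y (Suc i)\<close> is a double zero, so \<open>g 1\<close>
      already vanishes at \<open>y i\<close>.\<close>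
    with mono[of i "Suc i"] zero[of i "Suc i"] that show ?thesis
      by (intro exI[of _ "y i"]) simp
  qed
  then obtain z where z: "\<And>i. i \<le> N \<Longrightarrow> y i \<le> z i \<and> z i \<le> y (Suc i) \<and> g 1 (z i) = 0"
    and strict: "\<And>i. i \<le> N \<Longrightarrow> y i < y (Suc i) \<Longrightarrow> y i < z i \<and> z i < y (Suc i)"
    by metis
  have z_mono: "z i \<le> z j" if "i \<le> j" "j \<le> N" for i j
    using that
  proof (cases "i = j")
    case False
    then show ?thesis
      using that z[of i] z[of j] mono[of "Suc i" j] by simp
  qed simp
  \<comment> \<open>If \<open>z i = z j\<close> with \<open>i < j\<close>, then
    \<open>z i \<le> y (Suc i) \<le> y j \<le> z j\<close> are equalities, and strictness forces
    \<open>y i = y (Suc i)\<close> and \<open>y j = y (Suc j)\<close>. So \<open>y i\<close> up to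
    \<open>y (Suc j)\<close> coincide, and \<open>g (Suc j - i)\<close> vanishes there.\<close>
  have z_zero: "g (Suc (j - i)) (z i) = 0" if "i \<le> j" "j \<le> N" "z i = z j" for i j
  proof (cases "i = j")
    case True
    with z that show ?thesis by simp
  next
    case False
    with that have "y (Suc i) \<le> y j" "i \<le> N"
      using mono[of "Suc i" j] by simp_all
    then have "z i = y (Suc i)" "z j = y j"
      using z[of i] z[of j] that by simp_all
    then have "y i = y (Suc i)" "y j = y (Suc j)"
      using strict[of i] strict[of j] mono[of i "Suc i"] mono[of j "Suc j"] that \<open>i \<le> N\<close>
      by fastforce+
    with \<open>z i = y (Suc i)\<close> \<open>z j = y j\<close> that zero[of i "Suc j"] show ?thesis
      by (simp add: Suc_diff_le)
  qed
  have "\<exists>\<xi>\<in>{z 0..z N}. g (Suc N) \<xi> = 0"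
  proof (rule Suc.IH[of "\<lambda>k. g (Suc k)" z])
    show "p \<le> z 0" "z N \<le> q"
      using z[of 0] z[of N] Suc.prems(4,5) by simp_all
  qed (use der z_mono z_zero in auto)
  then show ?case
    using z[of 0] z[of N] by force
qed

text \<open>Sortedness forces all entries from position \<open>i\<close> to \<open>j\<close> to
  coincide, which gives at least \<open>j - i + 1\<close> occurrences.\<close>

lemma count_list_sorted_nth:
  assumes "sorted ys" and "i \<le> j" and "j < length ys" and "ys ! i = ys ! j"
  shows "j - i < count_list ys (ys ! i)"
proof -
  have "l < length ys \<and> ys ! i = ys ! l" if "l \<in> {i..j}" for l
    using that assms sorted_nth_mono[of ys i l] sorted_nth_mono[of ys l j] by force
  then have "{i..j} \<subseteq> {l. l < length ys \<and> ys ! i = ys ! l}"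
    by blast
  then have "card {i..j} \<le> card {l. l < length ys \<and> ys ! i = ys ! l}"
    by (rule card_mono[rotated]) simp
  then show ?thesis
    unfolding count_list_eq_length_filter length_filter_conv_card using \<open>i \<le> j\<close> by simp
qed

text \<open>Sorting turns multiplicities into blocks of consecutive equal entries, the form required
  by \<open>generalized_Rolle\<close>.\<close>

lemma generalized_Rolle_list:
  fixes g :: "nat \<Rightarrow> real \<Rightarrow> real"
  assumes der: "\<And>k u. k < N \<Longrightarrow> u \<in> {p..q} \<Longrightarrow>
      (g k has_real_derivative g (Suc k) u) (at u within {p..q})"
    and len: "length ys = Suc N" and sub: "set ys \<subseteq> {p..q}"
    and zero: "\<And>k a. k < count_list ys a \<Longrightarrow> g k a = 0"
  shows "\<exists>\<xi>\<in>{Min (set ys)..Max (set ys)}. g N \<xi> = 0"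
proof -
  define zs where "zs = sort ys"
  have zs: "sorted zs" "length zs = Suc N" "set zs = set ys"
    by (simp_all add: zs_def len)
  have count: "count_list zs = count_list ys"
    by (rule ext) (metis count_list_eq_length_filter count_mset mset_sort zs_def)
  have mem: "zs ! i \<in> set ys" if "i \<le> N" for i
    using that zs by (metis le_imp_less_Suc nth_mem)
  have "\<exists>\<xi>\<in>{zs ! 0..zs ! N}. g N \<xi> = 0"
  proof (rule generalized_Rolle[where g = g and p = p and q = q])
    show "zs ! i \<le> zs ! j" if "i \<le> j" "j \<le> N" for i j
      using that zs by (simp add: sorted_nth_mono)
    show "g (j - i) (zs ! i) = 0" if "i \<le> j" "j \<le> N" "zs ! i = zs ! j" for i j
      using that zs count_list_sorted_nth[of zs i j] by (intro zero) (simp add: count)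
    show "p \<le> zs ! 0" "zs ! N \<le> q"
      using mem[of 0] mem[of N] sub by auto
  qed (rule der)
  moreover have "Min (set ys) \<le> zs ! 0" "zs ! N \<le> Max (set ys)"
    using mem[of 0] mem[of N] by simp_all
  ultimately show ?thesis by force
qed

section \<open>The Hermite remainder and the two formulas\<close>

lemma Ck_on_has_real_derivative:
  assumes "Ck_on N S f" and "k < N" and "u \<in> S"
  shows "(nderiv_on S k f has_real_derivative nderiv_on S (Suc k) f u) (at u within S)"
  using assms vector_derivative_works[of "nderiv_on S k f" "at u within S"]
  by (simp add: Ck_on_def differentiable_on_def has_real_derivative_iff_has_vector_derivative)

text \<open>If \<open>t\<close> is a node, the node polynomial vanishes and \<xi> = \<open>t\<close>
  serves. Otherwise \<open>f - P\<close>, with \<open>P\<close> interpolating at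
  \<open>t # ys\<close>, has \<open>length ys + 1\<close> zeros, and Rolle applies.\<close>

lemma hermite_remainder:
  assumes f: "Ck_on (length ys) {p..q} f" and ys: "set ys \<subseteq> {p..q}" and t: "t \<in> {p..q}"
  shows "\<exists>\<xi>\<in>{Min (insert t (set ys))..Max (insert t (set ys))}.
    f t = poly (hermite {p..q} f ys) t
      + nderiv_on {p..q} (length ys) f \<xi> / fact (length ys) * poly (node_poly ys) t"
proof (cases "t \<in> set ys")
  case True
  then have "0 < count_list ys t"
    by (simp add: count_list_0_iff neq0_conv[symmetric] del: neq0_conv)
  then have "poly (hermite {p..q} f ys) t = f t"
    using is_hermite_hermite[of "{p..q}" f ys] True
    by (force simp: is_hermite_def interpolates_on_def)
  moreover have "poly (node_poly ys) t = 0"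
    using higher_pderiv_node_poly_eq_0[OF \<open>0 < count_list ys t\<close>] by simp
  ultimately show ?thesis
    by (intro bexI[of _ t]) simp_all
next
  case False
  define N where "N = length ys"
  define W where "W = node_poly ys"
  \<comment> \<open>This \<open>c\<close> makes \<open>P\<close> agree with \<open>f\<close> at
    \<open>t\<close> too. It is also the coefficient of degree \<open>N\<close> in \<open>P\<close>,
    so a zero of \<open>g N\<close> expresses it through the \<open>N\<close>-th derivative of
    \<open>f\<close>.\<close>
  define c where "c = (f t - poly (hermite {p..q} f ys) t) / poly W t"
  define P where "P = hermite {p..q} f ys + smult c W"
  define g where "g k u = nderiv_on {p..q} k f u - poly ((pderiv ^^ k) P) u" for k u
  have "poly W t \<noteq> 0"
    using higher_pderiv_node_poly_nonzero[of ys t] False by (simp add: W_def)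
  have "degree P \<le> N"
    using is_hermite_hermite[of "{p..q}" f ys]
    by (intro degree_le allI impI)
       (simp add: P_def W_def N_def is_hermite_def coeff_eq_0 monic_node_poly)
  moreover have "coeff P N = c"
    using is_hermite_hermite[of "{p..q}" f ys] monic_node_poly[of ys]
    by (simp add: P_def W_def N_def is_hermite_def)
  ultimately have top: "poly ((pderiv ^^ N) P) u = fact N * c" for u
    by (simp add: higher_pderiv_eq_fact_coeff)
  have "\<exists>\<xi>\<in>{Min (set (t # ys))..Max (set (t # ys))}. g N \<xi> = 0"
  proof (rule generalized_Rolle_list)
    show "(g k has_real_derivative g (Suc k) u) (at u within {p..q})"
      if "k < N" "u \<in> {p..q}" for k u
    proof -
      have "(poly ((pderiv ^^ k) P) has_real_derivative poly ((pderiv ^^ Suc k) P) u)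
          (at u within {p..q})"
        using poly_DERIV[of "(pderiv ^^ k) P" u] by (simp add: has_field_derivative_at_within)
      from DERIV_diff[OF Ck_on_has_real_derivative[OF f] this] that show ?thesis
        unfolding g_def[abs_def] N_def by blast
    qed
    show "g k a = 0" if k: "k < count_list (t # ys) a" for k a
    proof (cases "a = t")
      case True
      with False k have "k = 0" by simp
      with True \<open>poly W t \<noteq> 0\<close> show ?thesis
        by (simp add: g_def P_def c_def)
    next
      case False
      with k have "k < count_list ys a" by simp
      moreover from this have "a \<in> set ys"
        by (metis count_notin not_less_zero)
      ultimately show ?thesis
        using is_hermite_hermite[of "{p..q}" f ys]
        by (simp add: g_def P_def W_def higher_pderiv_add higher_pderiv_smult
            higher_pderiv_node_poly_eq_0 is_hermite_def interpolates_on_def)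
    qed
  qed (use ys t in \<open>auto simp: N_def\<close>)
  then obtain \<xi> where \<xi>: "\<xi> \<in> {Min (insert t (set ys))..Max (insert t (set ys))}" "g N \<xi> = 0"
    by auto
  then have "nderiv_on {p..q} N f \<xi> / fact N = c"
    by (simp add: g_def top)
  moreover have "f t = poly (hermite {p..q} f ys) t + c * poly W t"
    using \<open>poly W t \<noteq> 0\<close> by (simp add: c_def)
  ultimately show ?thesis
    using \<xi>(1) unfolding N_def W_def by (intro bexI[of _ \<xi>]) simp_all
qed

theorem theorem3p1:
  fixes p q t :: real and r n :: nat and x :: "nat \<Rightarrow> real" and f :: "real \<Rightarrow> real"
  assumes "r \<le> n"
    and "p \<le> q"
    and "\<And>i. i < r \<Longrightarrow> x i \<in> {p..q}"
    and "\<And>i. r \<le> i \<Longrightarrow> i \<le> n \<Longrightarrow> x i \<in> {p..q}"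
    and "inj_on x {r..n}"
    and "t \<in> {p..q}"
    and "Ck_on (n + 1) {p..q} f"
  shows "\<exists>\<xi>\<in>{Min (insert t (x ` {0..n}))..Max (insert t (x ` {0..n}))}.
    f t = (\<Sum>i<r. divdiff {p..q} f (map x [0..<Suc i]) * (\<Prod>j<i. t - x j))
          + neville {p..q} f x r t (n - r) r * (\<Prod>i<r. t - x i)
          + nderiv_on {p..q} (n + 1) f \<xi> / fact (n + 1) * (\<Prod>i\<le>n. t - x i)
    \<and> f t = (\<Sum>i<r. divdiff {p..q} f (map x [0..<Suc i]) * (\<Prod>j<i. t - x j))
          + aitken {p..q} f x r t (n - r) n * (\<Prod>i<r. t - x i)
          + nderiv_on {p..q} (n + 1) f \<xi> / fact (n + 1) * (\<Prod>i\<le>n. t - x i)"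
proof -
  define B where "B = map x [0..<r]"
  define L where "L = map x [0..<Suc n]"
  define h where "h ys = poly (hermite {p..q} f ys) t" for ys
  have prod: "poly (node_poly (map x [0..<m])) t = (\<Prod>i<m. t - x i)" for m
    by (simp add: poly_node_poly o_def prod.list_conv_set_nth atLeast0LessThan)
  have "L = B @ map x [r..<Suc n]"
    using \<open>r \<le> n\<close> upt_add_eq_append[of 0 r "Suc n - r"]
    by (simp add: L_def B_def del: upt_Suc flip: map_append)
  then have nev: "neville {p..q} f x r t (n - r) r * (\<Prod>i<r. t - x i) = h L - h B"
    using neville_hermite[OF assms(5), of r "n - r" "{p..q}" f t] \<open>r \<le> n\<close>
    by (simp add: B_def h_def prod del: upt_Suc)
  have ait: "aitken {p..q} f x r t (n - r) n * (\<Prod>i<r. t - x i) = h L - h B"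
    using aitken_hermite[OF assms(5), of "n - r" n "{p..q}" f t] \<open>r \<le> n\<close>
    by (simp add: B_def L_def h_def prod)
  have newton: "(\<Sum>i<r. divdiff {p..q} f (map x [0..<Suc i]) * (\<Prod>j<i. t - x j)) = h B"
    by (simp add: B_def h_def hermite_newton)
  have set: "set L = x ` {0..n}" and len: "length L = n + 1"
    by (auto simp: L_def atLeast0LessThan atLeast0AtMost less_Suc_eq_le simp del: upt_Suc)
  have "set L \<subseteq> {p..q}"
    unfolding set using assms(3,4) by (meson image_subsetI not_le atLeastAtMost_iff)
  moreover have "poly (node_poly L) t = (\<Prod>i\<le>n. t - x i)"
    unfolding L_def prod lessThan_Suc_atMost ..
  \<comment> \<open>Both iterates reduce to the same \<open>h L - h B\<close>, so one \<xi> from the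
    remainder at the \<open>n + 1\<close> nodes of \<open>L\<close> serves both formulas.\<close>
  ultimately obtain \<xi> where "\<xi> \<in> {Min (insert t (x ` {0..n}))..Max (insert t (x ` {0..n}))}"
    and "f t = h L + nderiv_on {p..q} (n + 1) f \<xi> / fact (n + 1) * (\<Prod>i\<le>n. t - x i)"
    using hermite_remainder[of L p q f t] assms(6,7) unfolding h_def set len by metis
  then show ?thesis
    unfolding newton nev ait by (intro bexI[of _ \<xi>]) simp_all
qed

end
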